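(* Let $n\ge 2k\ge 2$ and $i\in\{0,1,\ldots,k-1\}$. The generalized Johnson graph $J(n,k,i)$ admits perfect state transfer if and only if $n=2k$ and $i=0$.
   Context: For integers $n\ge 2k$ and $0\le i\le k$, $J(n,k,i)$ is the graph whose vertices are the $k$-subsets of $\{1,\ldots,n\}$, with $A\sim B$ iff $|A\cap B|=i$ (so $J(n,k,0)$ is the Kneser graph). For a simple graph $X$ with adjacency matrix $A$, let $\mathcal{H}_X(t)=e^{itA}$. $X$ admits perfect state transfer (PST) from a vertex $u$ to a vertex $v\neq u$ at time $\tau>0$ if $|\mathcal{H}_X(\tau)_{u,v}|=1$; $X$ admits PST if this happens for some $u\ne v$ and some $\tau>0$. *)

theory Defs
  imports Complex_Main
begin

definition adj_matrix :: "('a \<Rightarrow> 'a \<Rightarrow> bool) \<Rightarrow> 'a \<Rightarrow> 'a \<Rightarrow> complex" where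
  "adj_matrix E u v = (if E u v then 1 else 0)"

fun mat_pow :: "'a set \<Rightarrow> ('a \<Rightarrow> 'a \<Rightarrow> complex) \<Rightarrow> nat \<Rightarrow> 'a \<Rightarrow> 'a \<Rightarrow> complex" where
  "mat_pow V M 0 u v = (if u = v then 1 else 0)"
| "mat_pow V M (Suc m) u v = (\<Sum>w\<in>V. M u w * mat_pow V M m w v)"

definition transition_matrix :: "'a set \<Rightarrow> ('a \<Rightarrow> 'a \<Rightarrow> bool) \<Rightarrow> real \<Rightarrow> 'a \<Rightarrow> 'a \<Rightarrow> complex" where
  "transition_matrix V E t u v =
     (\<Sum>m. (\<i> * complex_of_real t) ^ m / of_nat (fact m) * mat_pow V (adj_matrix E) m u v)"

definition admits_PST :: "'a set \<Rightarrow> ('a \<Rightarrow> 'a \<Rightarrow> bool) \<Rightarrow> bool" where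
  "admits_PST V E \<longleftrightarrow>
     (\<exists>u\<in>V. \<exists>v\<in>V. u \<noteq> v \<and> (\<exists>\<tau>>0. cmod (transition_matrix V E \<tau> u v) = 1))"

definition johnson_vertices :: "nat \<Rightarrow> nat \<Rightarrow> nat set set" where
  "johnson_vertices n k = {A. A \<subseteq> {1..n} \<and> card A = k}"

definition johnson_adj :: "nat \<Rightarrow> nat set \<Rightarrow> nat set \<Rightarrow> bool" where
  "johnson_adj i A B \<longleftrightarrow> A \<noteq> B \<and> card (A \<inter> B) = i"

end

(* Put d = k - i. For disjoint pairs (x, g x), x in P, the product over P of [x in T] - [g x in T]
   is an eigenfunction of J(n,k,i) whose eigenvalue depends only on j = |P|; call it theta_j.
   Perfect transfer from u to v at time t forces H(u,w) = 0 for w distinct from v, hence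
   H(u,v) f(v) = exp(i t theta) f(u) for each eigenfunction f. With j = 1 this shows that v is
   the complement of u, so n = 2k; then pairing elements of u with elements of v gives
   exp(i t theta_j) = (-1)^j exp(i t theta_0) for all j <= k.

   Suppose 0 < d < k. We have theta_0 = C^2 with C = binomial(k,d), theta_k = (-1)^d C, and
   theta_0 - theta_1 is the even multiple 2 binomial(k-1,d-1) of C. If C is even, then
   theta_0 - theta_k is an odd multiple of C, which contradicts the phases for j = 1, k. If C is odd,
   there is a power of two q with 2q <= k and binomial(k-2q,d-q) odd; as (1+x)^(2q) is congruent to
   1 + 2x^q + x^(2q) modulo 4, theta_(2q) is not congruent to 1 = theta_0 modulo 4, which
   contradicts the phases for j = 1, 2q. *)

theory Submission
  imports Defs
begin

subsection \<open>Transition matrices\<close>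

lemma mat_pow_add:
  assumes "finite V" "u \<in> V"
  shows "mat_pow V M (p + q) u v = (\<Sum>w\<in>V. mat_pow V M p u w * mat_pow V M q w v)"
  using assms(2)
proof (induction p arbitrary: u)
  case 0
  have "(\<Sum>w\<in>V. mat_pow V M 0 u w * mat_pow V M q w v) = (\<Sum>w\<in>V. if u = w then mat_pow V M q w v else 0)"
    by (intro sum.cong) auto
  also have "\<dots> = mat_pow V M q u v"
    using assms(1) 0 by simp
  finally show ?case by simp
next
  case (Suc p)
  have "mat_pow V M (Suc p + q) u v
      = (\<Sum>x\<in>V. M u x * (\<Sum>w\<in>V. mat_pow V M p x w * mat_pow V M q w v))"
    using Suc.IH by simp
  also have "\<dots> = (\<Sum>w\<in>V. \<Sum>x\<in>V. M u x * mat_pow V M p x w * mat_pow V M q w v)"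
    by (subst sum.swap) (simp add: sum_distrib_left mult.assoc)
  also have "\<dots> = (\<Sum>w\<in>V. mat_pow V M (Suc p) u w * mat_pow V M q w v)"
    by (simp add: sum_distrib_right)
  finally show ?case .
qed

lemma mat_pow_1:
  assumes "finite V" "v \<in> V"
  shows "mat_pow V M 1 u v = M u v"
proof -
  have "mat_pow V M 1 u v = (\<Sum>w\<in>V. if w = v then M u w else 0)"
    unfolding One_nat_def mat_pow.simps by (intro sum.cong) auto
  then show ?thesis using assms by simp
qed

text \<open>The recursion peels a factor off on the left. Splitting \<open>m + 1\<close> by
  \<open>mat_pow_add\<close> peels one off on the right, and symmetry of \<open>M\<close> matches
  the two.\<close>

lemma mat_pow_sym:
  assumes "finite V" "\<And>x y. M x y = M y x" "u \<in> V" "v \<in> V"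
  shows "mat_pow V M m u v = mat_pow V M m v u"
  using assms(3,4)
proof (induction m arbitrary: u v)
  case (Suc m)
  have "mat_pow V M (Suc m) u v = (\<Sum>w\<in>V. mat_pow V M m v w * mat_pow V M 1 w u)"
    using Suc assms(2) mat_pow_1[OF assms(1)] by (auto intro!: sum.cong)
  also have "\<dots> = mat_pow V M (m + 1) v u"
    using mat_pow_add[OF assms(1)] Suc.prems by metis
  finally show ?case by simp
qed simp

lemma mat_pow_adj_real: "cnj (mat_pow V (adj_matrix E) m u v) = mat_pow V (adj_matrix E) m u v"
  by (induction m arbitrary: u) (auto simp: adj_matrix_def intro!: sum.cong)

lemma norm_mat_pow_adj_le: "norm (mat_pow V (adj_matrix E) m u v) \<le> of_nat (card V) ^ m"
proof (induction m arbitrary: u)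
  case (Suc m)
  have "norm (mat_pow V (adj_matrix E) (Suc m) u v)
      \<le> (\<Sum>w\<in>V. norm (adj_matrix E u w) * norm (mat_pow V (adj_matrix E) m w v))"
    by (simp add: sum_norm_le norm_mult)
  also have "\<dots> \<le> (\<Sum>w\<in>V. 1 * of_nat (card V) ^ m)"
    by (intro sum_mono mult_mono Suc.IH) (auto simp: adj_matrix_def)
  finally show ?case by simp
qed simp

definition transition_term :: "'a set \<Rightarrow> ('a \<Rightarrow> 'a \<Rightarrow> bool) \<Rightarrow> real \<Rightarrow> 'a \<Rightarrow> 'a \<Rightarrow> nat \<Rightarrow> complex" where
  "transition_term V E t u v m =
     (\<i> * complex_of_real t) ^ m / of_nat (fact m) * mat_pow V (adj_matrix E) m u v"

text \<open>Entries of the m-th power of A are at most \<open>card V ^ m\<close>, so the exponential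
  series of \<open>\<bar>t\<bar> * card V\<close> dominates. Absolute convergence is what the Cauchy
  product below relies on.\<close>

lemma summable_norm_transition_term: "summable (\<lambda>m. norm (transition_term V E t u v m))"
proof (rule summable_comparison_test', rule summable_exp)
  fix m
  have "norm (norm (transition_term V E t u v m))
      = \<bar>t\<bar> ^ m / fact m * norm (mat_pow V (adj_matrix E) m u v)"
    by (simp add: transition_term_def norm_mult norm_divide norm_power)
  also have "\<dots> \<le> \<bar>t\<bar> ^ m / fact m * of_nat (card V) ^ m"
    by (intro mult_left_mono norm_mat_pow_adj_le) auto
  also have "\<dots> = inverse (fact m) * (\<bar>t\<bar> * of_nat (card V)) ^ m"
    by (simp add: power_mult_distrib field_simps)
  finally show "norm (norm (transition_term V E t u v m))
      \<le> inverse (fact m) * (\<bar>t\<bar> * of_nat (card V)) ^ m" .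
qed

lemma transition_term_sums: "transition_term V E t u v sums transition_matrix V E t u v"
proof -
  have "transition_matrix V E t u v = suminf (transition_term V E t u v)"
    by (simp add: transition_matrix_def transition_term_def[abs_def])
  then show ?thesis
    using summable_sums[OF summable_norm_cancel[OF summable_norm_transition_term]] by metis
qed

lemma transition_matrix_eigenfunction:
  assumes "finite V" "u \<in> V"
    and eig: "\<And>x. x \<in> V \<Longrightarrow> (\<Sum>w\<in>V. adj_matrix E x w * f w) = c * f x"
  shows "(\<Sum>w\<in>V. transition_matrix V E t u w * f w) = exp (\<i> * complex_of_real t * c) * f u"
proof -
  have pow: "(\<Sum>w\<in>V. mat_pow V (adj_matrix E) m x w * f w) = c ^ m * f x" if "x \<in> V" for m x
    using that
  proof (induction m arbitrary: x)
    case 0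
    have "(\<Sum>w\<in>V. mat_pow V (adj_matrix E) 0 x w * f w) = (\<Sum>w\<in>V. if x = w then f w else 0)"
      by (intro sum.cong) auto
    then show ?case using assms(1) 0 by simp
  next
    case (Suc m)
    have "(\<Sum>w\<in>V. mat_pow V (adj_matrix E) (Suc m) x w * f w)
        = (\<Sum>y\<in>V. adj_matrix E x y * (\<Sum>w\<in>V. mat_pow V (adj_matrix E) m y w * f w))"
      by (subst sum_distrib_left, subst sum.swap) (simp add: sum_distrib_right mult.assoc)
    also have "\<dots> = (\<Sum>y\<in>V. c ^ m * (adj_matrix E x y * f y))"
      using Suc.IH by (intro sum.cong) auto
    also have "\<dots> = c ^ Suc m * f x"
      using eig[OF Suc.prems] by (simp add: sum_distrib_left[symmetric])
    finally show ?case .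
  qed
  have "(\<lambda>m. \<Sum>w\<in>V. transition_term V E t u w m * f w)
      sums (\<Sum>w\<in>V. transition_matrix V E t u w * f w)"
    by (intro sums_sum sums_mult2 transition_term_sums)
  also have "(\<lambda>m. \<Sum>w\<in>V. transition_term V E t u w m * f w)
      = (\<lambda>m. (\<i> * complex_of_real t * c) ^ m /\<^sub>R fact m * f u)"
  proof
    fix m
    have "(\<Sum>w\<in>V. transition_term V E t u w m * f w)
        = (\<i> * complex_of_real t) ^ m / of_nat (fact m) * (\<Sum>w\<in>V. mat_pow V (adj_matrix E) m u w * f w)"
      by (simp add: transition_term_def sum_distrib_left mult.assoc)
    also have "\<dots> = (\<i> * complex_of_real t) ^ m / of_nat (fact m) * (c ^ m * f u)"
      by (simp only: pow[OF assms(2)])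
    finally show "(\<Sum>w\<in>V. transition_term V E t u w m * f w)
        = (\<i> * complex_of_real t * c) ^ m /\<^sub>R fact m * f u"
      by (simp add: power_mult_distrib scaleR_conv_of_real field_simps)
  qed
  finally have 1: "(\<lambda>m. (\<i> * complex_of_real t * c) ^ m /\<^sub>R fact m * f u)
      sums (\<Sum>w\<in>V. transition_matrix V E t u w * f w)" .
  have "(\<lambda>m. (\<i> * complex_of_real t * c) ^ m /\<^sub>R fact m * f u)
      sums (exp (\<i> * complex_of_real t * c) * f u)"
    by (intro sums_mult2 exp_converges)
  with 1 show ?thesis by (rule sums_unique2)
qed

text \<open>This is the (u,u) entry of H(t) H(-t) = I. The Cauchy product of the two series has m-th
  coefficient proportional to (z + (-z))^m, by the binomial theorem, so only m = 0
  contributes.\<close>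

lemma transition_matrix_unitary_row:
  assumes "finite V" "u \<in> V" "\<And>x y. E x y \<longleftrightarrow> E y x"
  shows "(\<Sum>w\<in>V. (cmod (transition_matrix V E t u w))\<^sup>2) = 1"
proof -
  let ?A = "adj_matrix E" and ?H = "transition_matrix V E t" and ?z = "\<i> * complex_of_real t"
  let ?T = "transition_term V E"
  \<comment> \<open>A is real and symmetric, so conjugation turns t into -t, and the indices may be
    swapped. In the order \<open>w u\<close> the powers of A compose by
    \<open>mat_pow_add\<close>.\<close>
  have cnjH: "(\<lambda>m. ?T (-t) w u m) sums cnj (?H u w)" if "w \<in> V" for w
  proof -
    have "(\<lambda>m. cnj (?T t u w m)) sums cnj (?H u w)"
      using transition_term_sums[of V E t u w] by (simp add: sums_cnj)
    moreover have "cnj (?T t u w m) = ?T (-t) w u m" for m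
      using mat_pow_sym[of V ?A w u m] assms that
      by (simp add: transition_term_def mat_pow_adj_real adj_matrix_def)
    ultimately show ?thesis by simp
  qed
  have "(\<lambda>m. \<Sum>l\<le>m. ?T t u w l * ?T (-t) w u (m - l)) sums (?H u w * cnj (?H u w))"
    if "w \<in> V" for w
    using Cauchy_product_sums[OF summable_norm_transition_term summable_norm_transition_term,
        of V E t u w V E "-t" w u] sums_unique[OF cnjH[OF that]]
      sums_unique[OF transition_term_sums[of V E t u w]] by simp
  then have "(\<lambda>m. \<Sum>w\<in>V. \<Sum>l\<le>m. ?T t u w l * ?T (-t) w u (m - l))
      sums (\<Sum>w\<in>V. ?H u w * cnj (?H u w))"
    by (intro sums_sum) auto
  moreover have "(\<Sum>w\<in>V. \<Sum>l\<le>m. ?T t u w l * ?T (-t) w u (m - l)) = (if m = 0 then 1 else 0)" for m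
  proof -
    have "(\<Sum>w\<in>V. \<Sum>l\<le>m. ?T t u w l * ?T (-t) w u (m - l))
        = (\<Sum>l\<le>m. (?z ^ l / fact l) * ((-?z) ^ (m - l) / fact (m - l))
             * (\<Sum>w\<in>V. mat_pow V ?A l u w * mat_pow V ?A (m - l) w u))"
      by (subst sum.swap) (simp add: transition_term_def sum_distrib_left sum_divide_distrib mult_ac)
    also have "\<dots> = (\<Sum>l\<le>m. (?z ^ l / fact l) * ((-?z) ^ (m - l) / fact (m - l))
             * mat_pow V ?A m u u)"
      by (intro sum.cong refl) (simp add: mat_pow_add[OF assms(1,2), symmetric])
    also have "\<dots> = (\<Sum>l\<le>m. of_nat (m choose l) * ?z ^ l * (-?z) ^ (m - l))
             * (mat_pow V ?A m u u / fact m)"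
      unfolding sum_distrib_right
      by (intro sum.cong refl) (simp add: binomial_fact)
    also have "\<dots> = (?z + - ?z) ^ m * (mat_pow V ?A m u u / fact m)"
      by (simp only: binomial_ring)
    finally show ?thesis by (simp add: power_0_left)
  qed
  ultimately have "(\<lambda>m. if m = 0 then 1 else 0) sums (\<Sum>w\<in>V. ?H u w * cnj (?H u w))"
    by simp
  moreover have "(\<lambda>m. if m = 0 then 1 else 0 :: complex) sums 1"
    using sums_single[of 0 "\<lambda>_. 1::complex"] by simp
  ultimately have "(\<Sum>w\<in>V. ?H u w * cnj (?H u w)) = 1"
    by (rule sums_unique2)
  then have "complex_of_real (\<Sum>w\<in>V. (cmod (?H u w))\<^sup>2) = of_real 1"
    by (simp add: complex_norm_square del: of_real_power)
  then show ?thesis by (simp only: of_real_eq_iff)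
qed

text \<open>Row u has norm 1, so an entry of modulus 1 at v forces all other entries to vanish.
  Applying the row to an eigenfunction then leaves a single term.\<close>

lemma perfect_transfer_eigenfunction:
  assumes "finite V" "u \<in> V" "v \<in> V" "\<And>x y. E x y \<longleftrightarrow> E y x"
    and pst: "cmod (transition_matrix V E t u v) = 1"
    and eig: "\<And>x. x \<in> V \<Longrightarrow> (\<Sum>w\<in>V. adj_matrix E x w * f w) = c * f x"
  shows "transition_matrix V E t u v * f v = exp (\<i> * complex_of_real t * c) * f u"
proof -
  let ?H = "transition_matrix V E t"
  have "1 = (cmod (?H u v))\<^sup>2 + (\<Sum>w\<in>V-{v}. (cmod (?H u w))\<^sup>2)"
    using transition_matrix_unitary_row[OF assms(1,2), of E t] assms(1,3,4)
    by (simp add: sum.remove)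
  then have "(\<Sum>w\<in>V-{v}. (cmod (?H u w))\<^sup>2) = 0"
    using pst by simp
  then have "\<forall>w\<in>V-{v}. ?H u w = 0"
    using assms(1) by (subst (asm) sum_nonneg_eq_0_iff) auto
  then have "(\<Sum>w\<in>V. ?H u w * f w) = ?H u v * f v"
    using assms(1,3) by (simp add: sum.remove)
  then show ?thesis
    using transition_matrix_eigenfunction[OF assms(1,2) eig, of t] by simp
qed

subsection \<open>Eigenfunctions of the Johnson scheme\<close>

definition pair_fun :: "('a \<Rightarrow> 'a) \<Rightarrow> 'a set \<Rightarrow> 'a set \<Rightarrow> int" where
  "pair_fun g P T = (\<Prod>x\<in>P. of_bool (x \<in> T) - of_bool (g x \<in> T))"

text \<open>For J(n,k,i) the parameters are s = k, t = n - k and d = k - i.\<close>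

definition johnson_eigenvalue :: "nat \<Rightarrow> nat \<Rightarrow> nat \<Rightarrow> nat \<Rightarrow> int" where
  "johnson_eigenvalue j s t d =
     (\<Sum>h\<le>d. (-1) ^ h * of_nat ((j choose h) * ((s - j) choose (d - h)) * ((t - j) choose (d - h))))"

lemma johnson_eigenvalue_0: "johnson_eigenvalue 0 s t d = int ((s choose d) * (t choose d))"
proof -
  have "johnson_eigenvalue 0 s t d
      = (\<Sum>h\<le>d. if h = 0 then int ((s choose d) * (t choose d)) else 0)"
    unfolding johnson_eigenvalue_def by (intro sum.cong) (auto simp: binomial_eq_0)
  then show ?thesis by simp
qed

text \<open>Pascal's rule for \<open>Suc j choose h\<close>; the other factors agree because s - (j
  + 1) = (s - 1) - j. It mirrors the removal of one pair, which takes one element from a set of size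
  s and one from its complement of size t.\<close>

lemma johnson_eigenvalue_Suc:
  assumes "0 < s" "0 < t"
  shows "johnson_eigenvalue (Suc j) s t d = johnson_eigenvalue j (s - 1) (t - 1) d
    - (if d = 0 then 0 else johnson_eigenvalue j (s - 1) (t - 1) (d - 1))"
proof (cases d)
  case 0
  then show ?thesis by (simp add: johnson_eigenvalue_def)
next
  case (Suc e)
  define c where "c h = (int ((s - Suc j) choose (d - h)) * int ((t - Suc j) choose (d - h)))" for h
  have "johnson_eigenvalue (Suc j) s t d = (\<Sum>h\<le>Suc e. (-1) ^ h * int (Suc j choose h) * c h)"
    by (simp add: johnson_eigenvalue_def c_def Suc mult.assoc del: sum.atMost_Suc)
  also have "\<dots> = c 0 + (\<Sum>h\<le>e. (-1) ^ Suc h * int (j choose Suc h) * c (Suc h))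
      - (\<Sum>h\<le>e. (-1) ^ h * int (j choose h) * c (Suc h))"
    by (subst sum.atMost_Suc_shift)
      (simp add: algebra_simps sum.distrib sum_negf sum_subtractf)
  also have "c 0 + (\<Sum>h\<le>e. (-1) ^ Suc h * int (j choose Suc h) * c (Suc h))
      = (\<Sum>h\<le>Suc e. (-1) ^ h * int (j choose h) * c h)"
    by (subst sum.atMost_Suc_shift) simp
  also have "\<dots> = johnson_eigenvalue j (s - 1) (t - 1) d"
    by (simp add: johnson_eigenvalue_def c_def Suc mult.assoc del: sum.atMost_Suc)
  also have "(\<Sum>h\<le>e. (-1) ^ h * int (j choose h) * c (Suc h)) = johnson_eigenvalue j (s - 1) (t - 1) e"
    by (simp add: johnson_eigenvalue_def c_def Suc mult.assoc)
  finally show ?thesis using Suc by simp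
qed

section \<open>Pairing functions as eigenfunctions\<close>

lemma sum_Pow_insert:
  fixes F :: "'a set \<Rightarrow> 'b::comm_monoid_add"
  assumes "finite A" "x \<notin> A"
  shows "(\<Sum>T\<in>Pow (insert x A). F T) = (\<Sum>T\<in>Pow A. F T + F (insert x T))"
proof -
  have "(\<Sum>T\<in>Pow (insert x A). F T) = sum F (Pow A) + sum F (insert x ` Pow A)"
    unfolding Pow_insert using assms by (intro sum.union_disjoint) auto
  also have "sum F (insert x ` Pow A) = (\<Sum>T\<in>Pow A. F (insert x T))"
    using assms by (subst sum.reindex) (auto simp: inj_on_def)
  finally show ?thesis by (simp add: sum.distrib)
qed

text \<open>T is determined by the removed part S - T and the added part T - S, which can be chosen
  independently.\<close>

lemma card_sets_at_distance:
  assumes "finite W" "S \<subseteq> W"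
  shows "card {T \<in> Pow W. card (S - T) = a \<and> card (T - S) = b}
    = (card S choose a) * (card (W - S) choose b)"
proof -
  let ?X = "{A. A \<subseteq> S \<and> card A = a}" and ?Y = "{B. B \<subseteq> W - S \<and> card B = b}"
  have fin: "finite S" using assms finite_subset by auto
  have "bij_betw (\<lambda>T. (S - T, T - S)) {T \<in> Pow W. card (S - T) = a \<and> card (T - S) = b} (?X \<times> ?Y)"
    by (rule bij_betw_byWitness[where f' = "\<lambda>(A, B). (S - A) \<union> B"])
      (use assms in \<open>auto simp: double_diff intro: arg_cong[where f = card]\<close>)
  then have "card {T \<in> Pow W. card (S - T) = a \<and> card (T - S) = b} = card (?X \<times> ?Y)"
    by (rule bij_betw_same_card)
  also have "\<dots> = (card S choose a) * (card (W - S) choose b)"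
    using n_subsets[OF fin] n_subsets[of "W - S"] assms by (simp add: card_cartesian_product)
  finally show ?thesis .
qed

text \<open>Induction on P, removing a pair x, y = g x from W and S. Summing over all subsets of W,
  with S and d arbitrary, keeps the statement stable under this removal; the two distance conditions
  already force T to have the size of S.\<close>

lemma pair_fun_eigenfunction:
  assumes "finite P" "finite W" "S \<subseteq> W" "P \<subseteq> W" "inj_on g P" "g ` P \<subseteq> W - P"
  shows "(\<Sum>T\<in>Pow W. of_bool (card (S - T) = d \<and> card (T - S) = d) * pair_fun g P T)
    = johnson_eigenvalue (card P) (card S) (card (W - S)) d * pair_fun g P S"
  using assms
proof (induction P arbitrary: W S d rule: finite_induct)
  case empty
  have "(\<Sum>T\<in>Pow W. of_bool (card (S - T) = d \<and> card (T - S) = d) * pair_fun g {} T)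
      = int (card {T \<in> Pow W. card (S - T) = d \<and> card (T - S) = d})"
    using empty.prems(1) by (simp add: pair_fun_def of_bool_def sum.If_cases Int_def)
  then show ?case
    using card_sets_at_distance[OF empty.prems(1,2)]
    by (simp add: johnson_eigenvalue_0 pair_fun_def)
next
  case (insert x P)
  define y where "y = g x"
  define W' where "W' = W - {x, y}"
  define S' where "S' = S - {x, y}"
  define f where "f = pair_fun g P"
  define near where "near W S d T \<longleftrightarrow> card (S - T) = d \<and> card (T - S) = d" for W S :: "'a set" and d T
  have xy: "x \<noteq> y" "x \<in> W" "y \<in> W" "x \<notin> P" "y \<notin> P"
    using insert.prems insert.hyps by (auto simp: y_def)
  have W: "W = insert x (insert y W')" "finite W'" "x \<notin> insert y W'" "y \<notin> W'"
    using xy insert.prems by (auto simp: W'_def)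
  have gP: "z \<noteq> x \<and> z \<noteq> y \<and> g z \<noteq> x \<and> g z \<noteq> y" if "z \<in> P" for z
    using insert.prems insert.hyps that by (auto simp: y_def inj_on_def)
  have IH: "(\<Sum>T\<in>Pow W'. of_bool (near W' S' e T) * f T)
      = johnson_eigenvalue (card P) (card S') (card (W' - S')) e * f S'" for e
    unfolding near_def f_def
    using insert.prems gP by (intro insert.IH) (auto simp: W'_def S'_def image_subset_iff)
  \<comment> \<open>The pairs over P avoid x and y, so f does not see these two points.\<close>
  have f_cong: "f T = f T'" if "T - {x, y} = T' - {x, y}" for T T'
    unfolding f_def pair_fun_def
  proof (rule prod.cong)
    fix z assume "z \<in> P"
    then have "z \<in> T \<longleftrightarrow> z \<in> T'" "g z \<in> T \<longleftrightarrow> g z \<in> T'"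
      using gP that by blast+
    then show "of_bool (z \<in> T) - of_bool (g z \<in> T) = (of_bool (z \<in> T') - of_bool (g z \<in> T') :: int)"
      by simp
  qed simp
  have fx: "pair_fun g (insert x P) T = (of_bool (x \<in> T) - of_bool (y \<in> T)) * f T" for T
    using insert.hyps by (simp add: pair_fun_def f_def y_def)
  let ?N = "\<lambda>T. of_bool (near W S d T) :: int"
  have expand: "(\<Sum>T\<in>Pow W. F T)
      = (\<Sum>T\<in>Pow W'. F T + F (insert x T) + (F (insert y T) + F (insert x (insert y T))))"
    for F :: "'a set \<Rightarrow> int"
  proof -
    have "(\<Sum>T\<in>Pow W. F T) = (\<Sum>T\<in>Pow (insert y W'). F T + F (insert x T))"
      unfolding W(1) using sum_Pow_insert[of "insert y W'" x F] W(2,3) by simp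
    also have "\<dots> = (\<Sum>T\<in>Pow W'. F T + F (insert x T) + (F (insert y T) + F (insert x (insert y T))))"
      by (rule sum_Pow_insert[OF W(2,4)])
    finally show ?thesis .
  qed
  have "(\<Sum>T\<in>Pow W. ?N T * pair_fun g (insert x P) T)
      = (\<Sum>T\<in>Pow W'. ?N T * pair_fun g (insert x P) T
           + ?N (insert x T) * pair_fun g (insert x P) (insert x T)
         + (?N (insert y T) * pair_fun g (insert x P) (insert y T)
           + ?N (insert x (insert y T)) * pair_fun g (insert x P) (insert x (insert y T))))"
    using expand[of "\<lambda>T. ?N T * pair_fun g (insert x P) T"] .
  \<comment> \<open>The factor of the pair x, y vanishes on sets that contain both or neither; it is
    1 if only x is present and -1 if only y is.\<close>
  also have "\<dots> = (\<Sum>T\<in>Pow W'. (?N (insert x T) - ?N (insert y T)) * f T)"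
  proof (rule sum.cong)
    fix T assume "T \<in> Pow W'"
    then have "x \<notin> T" "y \<notin> T" using W by auto
    moreover have "f (insert x T) = f T" "f (insert y T) = f T"
      by (auto intro: f_cong)
    ultimately show "?N T * pair_fun g (insert x P) T
           + ?N (insert x T) * pair_fun g (insert x P) (insert x T)
         + (?N (insert y T) * pair_fun g (insert x P) (insert y T)
           + ?N (insert x (insert y T)) * pair_fun g (insert x P) (insert x (insert y T)))
         = (?N (insert x T) - ?N (insert y T)) * f T"
      using xy by (simp add: fx algebra_simps)
  qed simp
  finally have sum_eq: "(\<Sum>T\<in>Pow W. ?N T * pair_fun g (insert x P) T)
    = (\<Sum>T\<in>Pow W'. (?N (insert x T) - ?N (insert y T)) * f T)" .
  have fS: "f S' = f S" by (rule f_cong) (auto simp: S'_def)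
  have finS: "finite S" using insert.prems finite_subset by auto
  \<comment> \<open>When S contains a but not b, adding a to T agrees with S on the pair. Adding b
    instead costs one element in each difference, which leaves distance d - 1; the guard
    \<open>d \<noteq> 0\<close> prevents truncation.\<close>
  have split: "near W S d (insert a T) \<longleftrightarrow> near W' S' d T"
      "near W S d (insert b T) \<longleftrightarrow> d \<noteq> 0 \<and> near W' S' (d - 1) T"
    if "{a, b} = {x, y}" "a \<in> S" "b \<notin> S" "T \<in> Pow W'" for a b T
  proof -
    have ab: "a = x \<and> b = y \<or> a = y \<and> b = x"
      using that(1) by (simp add: doubleton_eq_iff)
    have "T \<subseteq> W'" using that(4) by simp
    then have T: "finite T" "a \<notin> T" "b \<notin> T" "a \<noteq> b"
      using ab W(3,4) xy(1) finite_subset[OF _ W(2)] by blast+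
    have S'_ab: "S' = S - {a, b}" using ab by (auto simp: S'_def)
    have diffs: "S - insert a T = S' - T" "insert a T - S = T - S'"
      "S - insert b T = insert a (S' - T)" "insert b T - S = insert b (T - S')"
      unfolding S'_ab using that(2,3) T(2-4) by blast+
    have "card (insert a (S' - T)) = Suc (card (S' - T))" "card (insert b (T - S')) = Suc (card (T - S'))"
      using finS T by (simp_all add: S'_ab)
    then have "near W S d (insert b T) \<longleftrightarrow> Suc (card (S' - T)) = d \<and> Suc (card (T - S')) = d"
      by (simp only: near_def diffs)
    then show "near W S d (insert b T) \<longleftrightarrow> d \<noteq> 0 \<and> near W' S' (d - 1) T"
      unfolding near_def by arith
    show "near W S d (insert a T) \<longleftrightarrow> near W' S' d T"
      by (simp only: near_def diffs)
  qed
  have reduce: "(\<Sum>T\<in>Pow W'. (?N (insert a T) - ?N (insert b T)) * f T)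
      = johnson_eigenvalue (card (insert x P)) (card S) (card (W - S)) d * f S"
    if ab: "{a, b} = {x, y}" "a \<in> S" "b \<notin> S" for a b
  proof -
    let ?e = "\<lambda>e. johnson_eigenvalue (card P) (card S') (card (W' - S')) e * f S'"
    have "(\<Sum>T\<in>Pow W'. (?N (insert a T) - ?N (insert b T)) * f T)
        = (\<Sum>T\<in>Pow W'. of_bool (near W' S' d T) * f T
             - (if d = 0 then 0 else of_bool (near W' S' (d - 1) T) * f T))"
      using split[OF ab] by (intro sum.cong) (auto simp: algebra_simps)
    also have "\<dots> = ?e d - (if d = 0 then 0 else ?e (d - 1))"
      by (simp add: sum_subtractf IH)
    finally have "(\<Sum>T\<in>Pow W'. (?N (insert a T) - ?N (insert b T)) * f T)
      = ?e d - (if d = 0 then 0 else ?e (d - 1))" .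
    moreover have "S' = S - {a}" "W' - S' = (W - S) - {b}"
      using ab xy by (auto simp: S'_def W'_def doubleton_eq_iff)
    then have "card S' = card S - 1" "card (W' - S') = card (W - S) - 1"
      using ab xy insert.prems by (auto simp: doubleton_eq_iff)
    moreover have "0 < card S" "0 < card (W - S)"
      using ab xy insert.prems finS by (auto simp: card_gt_0_iff doubleton_eq_iff)
    ultimately show ?thesis
      using insert.hyps
      by (cases "d = 0") (simp_all add: johnson_eigenvalue_Suc fS left_diff_distrib)
  qed
  have goal: "(\<Sum>T\<in>Pow W. ?N T * pair_fun g (insert x P) T)
    = johnson_eigenvalue (card (insert x P)) (card S) (card (W - S)) d * pair_fun g (insert x P) S"
  proof (cases "x \<in> S \<longleftrightarrow> y \<in> S")
    case True
    \<comment> \<open>S is invariant under exchanging x and y, so the two terms cancel; the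
      eigenfunction also vanishes at S.\<close>
    have "near W S d (insert x T) \<longleftrightarrow> near W S d (insert y T)" if "T \<in> Pow W'" for T
    proof -
      have T: "finite T" "x \<notin> T" "y \<notin> T"
        using that W finite_subset by auto
      show ?thesis
      proof (cases "x \<in> S")
        case in_S: True
        with True T have "S - insert x T = insert y (S' - T)" "S - insert y T = insert x (S' - T)"
          "insert x T - S = T - S" "insert y T - S = T - S"
          using xy by (auto simp: S'_def)
        then show ?thesis using finS by (simp add: near_def S'_def)
      next
        case False
        with True T have "insert x T - S = insert x (T - S)" "insert y T - S = insert y (T - S)"
          "S - insert x T = S - T" "S - insert y T = S - T"
          by auto
        then show ?thesis using T by (simp add: near_def)
      qed
    qed
    then have "(\<Sum>T\<in>Pow W'. (?N (insert x T) - ?N (insert y T)) * f T) = 0"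
      by simp
    then show ?thesis using True sum_eq by (simp add: fx)
  next
    case False
    show ?thesis
    proof (cases "x \<in> S")
      case True
      with False reduce[of x y] sum_eq show ?thesis by (simp add: fx)
    next
      case nx: False
      \<comment> \<open>With y in S and x outside, the roles are exchanged. The change of sign is
        the factor -1 of the pair at S.\<close>
      have "(\<Sum>T\<in>Pow W'. (?N (insert x T) - ?N (insert y T)) * f T)
        = - (\<Sum>T\<in>Pow W'. (?N (insert y T) - ?N (insert x T)) * f T)"
        by (simp add: sum_negf[symmetric] algebra_simps)
      with nx False reduce[of y x] sum_eq show ?thesis by (simp add: fx insert_commute)
    qed
  qed
  then show ?case unfolding near_def .
qed

subsection \<open>Parity of the eigenvalues\<close>

text \<open>Lucas' theorem modulo 2, for the last binary digit.\<close>

lemma odd_binomial_halve: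
  "odd (n choose m) \<longleftrightarrow> odd ((n div 2) choose (m div 2)) \<and> (odd m \<longrightarrow> odd n)"
proof (induction n arbitrary: m)
  case 0
  then show ?case by (cases "m = 0 \<or> m = 1") (auto simp: binomial_eq_0)
next
  case (Suc n)
  show ?case
  proof (cases m)
    case 0
    then show ?thesis by simp
  next
    case (Suc l)
    have "odd (Suc n choose m) \<longleftrightarrow> (odd (n choose l) \<noteq> odd (n choose Suc l))"
      by (simp add: Suc)
    then show ?thesis
      using Suc.IH[of l] Suc.IH[of "Suc l"] unfolding Suc
      by (cases "even n"; cases "even l") (auto elim!: evenE oddE)
  qed
qed

text \<open>Halving k and d preserves oddness, and a witness p for the halves lifts to
  \<open>Suc p\<close>, since subtracting multiples of 2 commutes with halving. The descent stops at
  d = 1 or d = k - 1, where p = 0 works: the coefficient is then \<open>(k - 2) choose 0\<close> or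
  \<open>(k - 2) choose (k - 2)\<close>.\<close>

lemma odd_binomial_witness:
  assumes "odd (k choose d)" "0 < d" "d < k"
  shows "\<exists>p. 2 ^ Suc p \<le> k \<and> 2 ^ p \<le> d \<and> odd ((k - 2 ^ Suc p) choose (d - 2 ^ p))"
  using assms
proof (induction k arbitrary: d rule: less_induct)
  case (less k)
  define K D where "K = k div 2" and "D = d div 2"
  have odd_KD: "odd (K choose D)" and par: "odd d \<longrightarrow> odd k"
    using less.prems(1) odd_binomial_halve[of k d] by (auto simp: K_def D_def)
  have "D \<le> K" using less.prems(3) by (simp add: K_def D_def div_le_mono)
  then consider "D = 0" | "D = K" | "0 < D" "D < K" by linarith
  then show ?case
  proof cases
    case 1
    then have "d = 1" using less.prems(2) by (auto simp: D_def)
    then show ?thesis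
      using less.prems(3) by (intro exI[of _ 0]) auto
  next
    case 2
    then have "k = Suc d" using less.prems(3) unfolding K_def D_def by presburger
    moreover have "2 \<le> k" using less.prems by simp
    ultimately show ?thesis
      by (intro exI[of _ 0]) auto
  next
    case 3
    have "K < k" using less.prems by (simp add: K_def)
    from less.IH[OF this odd_KD 3] obtain p
      where p: "2 ^ Suc p \<le> K" "2 ^ p \<le> D" "odd ((K - 2 ^ Suc p) choose (D - 2 ^ p))" by blast
    have "(k - 2 ^ Suc (Suc p)) div 2 = K - 2 ^ Suc p" "(d - 2 ^ Suc p) div 2 = D - 2 ^ p"
      by (simp_all add: K_def D_def)
    moreover have le: "2 ^ Suc (Suc p) \<le> k" "2 ^ Suc p \<le> d"
      using p by (auto simp: K_def D_def)
    moreover have "odd (d - 2 ^ Suc p) \<longrightarrow> odd (k - 2 ^ Suc (Suc p))"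
      using par le by simp
    ultimately have "odd ((k - 2 ^ Suc (Suc p)) choose (d - 2 ^ Suc p))"
      using p(3) odd_binomial_halve by metis
    with le show ?thesis by blast
  qed
qed

text \<open>All binary digits of 2^p - 1 are 1, so no digit of h is obstructed in Lucas'
  theorem.\<close>

lemma odd_binomial_two_power_minus_one: "h < 2 ^ p \<Longrightarrow> odd ((2 ^ p - 1) choose h)"
proof (induction p arbitrary: h)
  case (Suc p)
  have "(2 ^ Suc p - 1 :: nat) div 2 = 2 ^ p - 1" "odd (2 ^ Suc p - 1 :: nat)"
    by auto
  moreover have "h div 2 < 2 ^ p" using Suc.prems by auto
  ultimately show ?case using Suc.IH odd_binomial_halve by metis
qed simp

text \<open>The absorption identity writes the central coefficient as twice a binomial coefficient
  of 2^(p+1) - 1, which is odd.\<close>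

lemma binomial_two_power_central:
  "\<exists>m. (2 ^ Suc p choose 2 ^ p) = 4 * m + (2::nat)"
proof -
  let ?c = "(2 ^ Suc p - 1) choose (2 ^ p - 1)"
  have "2 ^ p * (2 ^ Suc p choose 2 ^ p) = 2 ^ Suc p * ?c"
    using times_binomial_minus1_eq[of "2 ^ p" "2 ^ Suc p"] by simp
  then have "(2 ^ Suc p choose 2 ^ p) = 2 * ?c" by simp
  moreover have "odd ?c"
    by (rule odd_binomial_two_power_minus_one) (simp add: less_imp_diff_less)
  ultimately show ?thesis by (auto elim!: oddE)
qed

text \<open>By the absorption identity, 2^(p+1) divides h times the coefficient. If the coefficient
  is not divisible by 4, then 2^p must divide h, which leaves only the excluded values.\<close>

lemma binomial_two_power_dvd_4:
  assumes "h \<noteq> 0" "h \<noteq> 2 ^ p" "h \<noteq> 2 ^ Suc p"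
  shows "4 dvd (2 ^ Suc p choose h :: nat)"
proof (rule ccontr)
  let ?C = "2 ^ Suc p choose h"
  assume not_dvd: "\<not> 4 dvd ?C"
  then have "h < 2 ^ Suc p"
    using assms(3) binomial_eq_0[of "2 ^ Suc p" h] by (metis dvd_0_right linorder_neqE_nat)
  have "h * ?C = 2 ^ Suc p * ((2 ^ Suc p - 1) choose (h - 1))"
    using times_binomial_minus1_eq[of h "2 ^ Suc p"] assms(1) by simp
  then have dvd: "2 ^ Suc p dvd h * ?C" by simp
  have "2 ^ p dvd h"
  proof (cases "even ?C")
    case True
    then obtain c where c: "?C = 2 * c" by (elim evenE)
    with not_dvd have "odd c" by auto
    have "2 ^ p dvd h * c"
      using dvd unfolding c by simp
    with \<open>odd c\<close> show ?thesis
      by (simp add: coprime_dvd_mult_left_iff)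
  next
    case False
    then have "2 ^ Suc p dvd h"
      using dvd by (subst (asm) coprime_dvd_mult_left_iff) auto
    then show ?thesis by (rule power_le_dvd) simp
  qed
  then obtain r where "h = 2 ^ p * r" by (elim dvdE)
  with \<open>h < 2 ^ Suc p\<close> have "r < 2" by simp
  with \<open>h = 2 ^ p * r\<close> assms show False by (auto simp: less_2_cases_iff)
qed

section \<open>Eigenvalues for n = 2k and their residues modulo 4\<close>

lemma johnson_eigenvalue_self: "johnson_eigenvalue k k k d = (-1) ^ d * int (k choose d)"
proof -
  have "johnson_eigenvalue k k k d = (\<Sum>h\<le>d. if h = d then (-1) ^ d * int (k choose d) else 0)"
    unfolding johnson_eigenvalue_def by (intro sum.cong) (auto simp: binomial_eq_0)
  then show ?thesis by simp
qed

text \<open>With a = \<open>(k - 1) choose d\<close> and b = \<open>(k - 1) choose (d - 1)\<close>,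
  the recursion gives (a + b)^2 - (a^2 - b^2) = 2 b (a + b).\<close>

lemma johnson_eigenvalue_0_diff_1:
  assumes "0 < k" "0 < d"
  shows "johnson_eigenvalue 0 k k d - johnson_eigenvalue 1 k k d
    = 2 * int ((k choose d) * ((k - 1) choose (d - 1)))"
proof -
  obtain l e where "k = Suc l" "d = Suc e" using assms by (metis gr0_implies_Suc)
  then show ?thesis
    by (simp add: johnson_eigenvalue_Suc johnson_eigenvalue_0 algebra_simps)
qed

lemma square_mod_4_cases: "\<exists>y. x\<^sup>2 = 4 * y \<or> x\<^sup>2 = 4 * y + 1" for x :: int
proof (cases "even x")
  case True
  then obtain y where "x = 2 * y" by (elim evenE)
  then show ?thesis by (intro exI[of _ "y * y"]) (simp add: power2_eq_square)
next
  case False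
  then obtain y where "x = 2 * y + 1" by (elim oddE)
  then show ?thesis
    by (intro exI[of _ "y * y + y"]) (simp add: power2_eq_square algebra_simps)
qed

text \<open>Put q = 2^p. Modulo 4 only h = 0, q, 2q contribute. The middle term is 2 since
  \<open>b q\<close> is odd, and the outer ones are squares, hence 0 or 1; the total is 2, 3 or
  0.\<close>

lemma johnson_eigenvalue_two_power_mod_4:
  assumes "2 ^ p \<le> d" "odd ((k - 2 ^ Suc p) choose (d - 2 ^ p))"
  shows "johnson_eigenvalue (2 ^ Suc p) k k d \<noteq> 4 * z + 1"
proof -
  define q :: nat where "q = 2 ^ p"
  have qs: "2 ^ Suc p = 2 * q" "0 < q" by (simp_all add: q_def)
  define b where "b h = int ((k - 2 * q) choose (d - h))" for h
  define f where "f h = (-1) ^ h * int (2 * q choose h) * (b h)\<^sup>2" for h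
  have "4 dvd f h" if "h \<notin> {0, q, 2 * q}" for h
  proof -
    have "4 dvd (2 * q choose h)"
      using binomial_two_power_dvd_4[of h p] that unfolding qs q_def[symmetric] by auto
    then have "int 4 dvd int (2 * q choose h)" by (rule of_nat_dvd_iff[THEN iffD2])
    then show ?thesis by (simp add: f_def)
  qed
  then have "4 dvd (\<Sum>h\<in>{..d} - {0, q, 2 * q}. f h)"
    by (intro dvd_sum) auto
  then obtain r where r: "(\<Sum>h\<in>{..d} - {0, q, 2 * q}. f h) = 4 * r" by (elim dvdE)
  obtain m where m: "(2 * q choose q) = 4 * m + 2"
    using binomial_two_power_central[of p] unfolding qs q_def[symmetric] by blast
  have "q \<le> d" using assms by (simp add: q_def)
  have "johnson_eigenvalue (2 * q) k k d = (\<Sum>h\<le>d. f h)"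
    by (simp add: johnson_eigenvalue_def f_def b_def power2_eq_square mult.assoc)
  also have "\<dots> = (\<Sum>h\<in>{..d} - {0, q, 2 * q}. f h) + (\<Sum>h\<in>{..d} \<inter> {0, q, 2 * q}. f h)"
    by (subst sum.Int_Diff[of _ _ "{0, q, 2 * q}"]) auto
  \<comment> \<open>The term h = 2q is absent when d < 2q. It needs the guard because
    \<open>d - 2 * q\<close> would truncate to 0 and make \<open>b (2 * q)\<close> equal to
    1.\<close>
  also have "(\<Sum>h\<in>{..d} \<inter> {0, q, 2 * q}. f h) = f 0 + f q + (if 2 * q \<le> d then f (2 * q) else 0)"
    using \<open>q \<le> d\<close> \<open>0 < q\<close> by (simp add: Int_insert_right)
  also have "f 0 = (b 0)\<^sup>2" by (simp add: f_def)
  also have "f (2 * q) = (b (2 * q))\<^sup>2" by (simp add: f_def)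
  finally have e: "johnson_eigenvalue (2 * q) k k d
    = 4 * r + ((b 0)\<^sup>2 + f q + (if 2 * q \<le> d then b (2 * q) else 0)\<^sup>2)"
    by (simp add: r)
  have "odd (b q)" using assms(2) by (simp add: b_def q_def)
  then have "odd ((b q)\<^sup>2)" by simp
  moreover obtain y where "(b q)\<^sup>2 = 4 * y \<or> (b q)\<^sup>2 = 4 * y + 1"
    using square_mod_4_cases by blast
  moreover have "even (4 * y)" by simp
  ultimately have y: "(b q)\<^sup>2 = 4 * y + 1" by metis
  have "f q = (-1) ^ q * (4 * int m + 2) * (4 * y + 1)"
    by (simp add: f_def m y)
  also have "\<dots> = (-1) ^ q * (4 * (4 * int m * y + int m + 2 * y) + 2)"
    by (simp add: algebra_simps)
  finally have "f q = 4 * (4 * int m * y + int m + 2 * y) + 2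
      \<or> f q = 4 * (- (4 * int m * y + int m + 2 * y) - 1) + 2"
    by (cases "even q") auto
  then obtain w where F: "f q = 4 * w + 2" by blast
  define X where "X = (b 0)\<^sup>2"
  define F where "F = f q"
  define Y where "Y = (if 2 * q \<le> d then b (2 * q) else 0)\<^sup>2"
  obtain x' where "X = 4 * x' \<or> X = 4 * x' + 1"
    unfolding X_def using square_mod_4_cases by blast
  moreover obtain y' where "Y = 4 * y' \<or> Y = 4 * y' + 1"
    unfolding Y_def using square_mod_4_cases by blast
  ultimately have "4 * r + (X + F + Y) \<noteq> 4 * z + 1"
    using F unfolding F_def[symmetric] by (elim disjE) presburger+
  then show ?thesis unfolding qs e X_def Y_def F_def .
qed

text \<open>Computing z^(2mw) from either hypothesis gives (-1)^w = 1.\<close>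

lemma odd_power_contradiction:
  fixes z :: complex
  assumes "z ^ (2 * m) = -1" "z ^ (2 * w) = 1"
  shows "even w"
proof -
  have "(-1) ^ w = (z ^ (2 * w)) ^ m"
    unfolding assms(1)[symmetric] by (simp add: power_mult[symmetric] mult_ac)
  then show ?thesis using assms(2) by (cases "even w") auto
qed

text \<open>The map \<open>e\<close> turns differences of integers into quotients, so the hypothesis
  says that \<open>e\<close> maps the gap between eigenvalues 0 and j to (-1)^j. Suitable gaps are
  compared as powers of \<open>e C\<close> or of \<open>e 1\<close>.\<close>

lemma no_alternating_phases:
  assumes d: "0 < d" "d < k"
    and phase: "\<And>j. j \<le> k \<Longrightarrow> exp (\<i> * complex_of_real t * of_int (johnson_eigenvalue j k k d))
      = (-1) ^ j * exp (\<i> * complex_of_real t * of_int (johnson_eigenvalue 0 k k d))"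
  shows False
proof -
  define e where "e x = exp (\<i> * complex_of_real t * of_int x)" for x :: int
  have e_diff: "e (x - y) = e x / e y" for x y
    by (simp add: e_def right_diff_distrib exp_diff)
  have e_mult: "e (x * int m) = e x ^ m" for x m
    by (simp add: e_def exp_of_nat_mult[symmetric] mult_ac)
  let ?\<theta> = "\<lambda>j. johnson_eigenvalue j k k d"
  define C where "C = k choose d"
  define C' where "C' = (k - 1) choose (d - 1)"
  have e_nz: "e x \<noteq> 0" for x by (simp add: e_def)
  have gap: "e (?\<theta> 0 - ?\<theta> j) = (-1) ^ j" if "j \<le> k" for j
  proof -
    have "e (?\<theta> j) = (-1) ^ j * e (?\<theta> 0)"
      using phase[OF that] by (simp add: e_def)
    then show ?thesis
      using e_nz by (cases "even j") (auto simp: e_diff field_simps)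
  qed
  have \<theta>0: "?\<theta> 0 = int C * int C" by (simp add: johnson_eigenvalue_0 C_def)
  \<comment> \<open>The gap for j = 1 in two forms, with an even multiplier each time: a power of
    \<open>e C\<close> for even C, a power of \<open>e 1\<close> for odd C.\<close>
  have gap1: "e (int C * int (2 * C')) = -1" "e (1 * int (2 * (C * C'))) = -1"
    using gap[of 1] johnson_eigenvalue_0_diff_1[of k d] d by (simp_all add: C_def C'_def mult_ac)
  show False
  proof (cases "even C")
    case True
    have "0 < C" using d by (simp add: C_def)
    \<comment> \<open>The gap for j = k is C^2 - (-1)^d C, and this is C w.\<close>
    define w where "w = (if even d then C - 1 else C + 1)"
    have "odd w" using True \<open>0 < C\<close> by (simp add: w_def)
    have "?\<theta> 0 - ?\<theta> k = int C * int w"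
      using \<open>0 < C\<close> by (simp add: \<theta>0 johnson_eigenvalue_self C_def[symmetric] w_def algebra_simps of_nat_diff)
    then have "e (int C) ^ w = (-1) ^ k"
      using gap[of k] by (simp only: e_mult order_refl)
    \<comment> \<open>Squaring removes the sign (-1)^k.\<close>
    then have "e (int C) ^ (2 * w) = 1"
      by (cases "even k") (simp_all add: mult.commute[of 2] power_mult)
    moreover have "e (int C) ^ (2 * C') = -1"
      using gap1(1) by (simp only: e_mult)
    ultimately show False
      using odd_power_contradiction \<open>odd w\<close> by blast
  next
    case False
    then obtain p where p: "2 ^ Suc p \<le> k" "2 ^ p \<le> d" "odd ((k - 2 ^ Suc p) choose (d - 2 ^ p))"
      using odd_binomial_witness[of k d] d by (auto simp: C_def)
    define x where "x = ?\<theta> 0 - ?\<theta> (2 ^ Suc p)"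
    have "odd (?\<theta> 0)" using False by (simp add: \<theta>0)
    moreover obtain z where "?\<theta> 0 = 4 * z \<or> ?\<theta> 0 = 4 * z + 1"
      using square_mod_4_cases[of "int C"] by (auto simp: \<theta>0 power2_eq_square)
    ultimately have z: "?\<theta> 0 = 4 * z + 1" by auto
    have "\<not> 4 dvd x"
    proof
      assume "4 dvd x"
      then obtain y where "x = 4 * y" by (elim dvdE)
      then have "?\<theta> (2 ^ Suc p) = 4 * (z - y) + 1"
        using z by (simp add: x_def)
      then show False
        using johnson_eigenvalue_two_power_mod_4[OF p(2,3)] by blast
    qed
    then have "\<not> 4 dvd nat \<bar>x\<bar>"
      by (simp add: dvd_nat_abs_iff)
    \<comment> \<open>As 4 does not divide x, its absolute value is w or 2w with w odd; either way
      \<open>e x = 1\<close> yields \<open>e 1 ^ (2 * w) = 1\<close>.\<close>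
    then obtain w where w: "odd w" "nat \<bar>x\<bar> = w \<or> nat \<bar>x\<bar> = 2 * w"
    proof (cases "odd (nat \<bar>x\<bar>)")
      case False
      then obtain w where w: "nat \<bar>x\<bar> = 2 * w" by blast
      with \<open>\<not> 4 dvd nat \<bar>x\<bar>\<close> have "odd w" by (metis dvd_refl mult_dvd_mono mult_2 numeral_Bit0 numeral_times_numeral num_double)
      with w that show ?thesis by blast
    qed (use that in blast)
    have "e x = 1" using gap[OF p(1)] by (simp add: x_def)
    then have "e \<bar>x\<bar> = 1"
      using e_diff[of 0 x] by (cases "x \<ge> 0") (auto simp: e_def)
    then have "e 1 ^ nat \<bar>x\<bar> = 1"
      using e_mult[of 1 "nat \<bar>x\<bar>"] by simp
    then have "e 1 ^ (2 * w) = 1"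
      using w(2) by (auto simp: mult.commute[of 2] power_mult)
    moreover have "e 1 ^ (2 * (C * C')) = -1"
      using gap1(2) by (simp only: e_mult)
    ultimately show False
      using odd_power_contradiction \<open>odd w\<close> by blast
  qed
qed

subsection \<open>Perfect state transfer\<close>

lemma finite_johnson_vertices: "finite (johnson_vertices n k)"
  by (rule finite_subset[of _ "Pow {1..n}"]) (auto simp: johnson_vertices_def)

lemma johnson_adj_commute: "johnson_adj i A B \<longleftrightarrow> johnson_adj i B A"
  by (auto simp: johnson_adj_def Int_commute)

text \<open>For k-sets, meeting in i points means that both differences have k - i elements; i < k
  rules out T = S. Subsets of other sizes are never at such a distance from S, so the sum extends to
  the whole power set.\<close>

lemma johnson_adj_pair_fun:
  assumes "i < k" "P \<subseteq> {1..n}" "inj_on g P" "g ` P \<subseteq> {1..n} - P" "S \<in> johnson_vertices n k"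
  shows "(\<Sum>T\<in>johnson_vertices n k. adj_matrix (johnson_adj i) S T * of_int (pair_fun g P T))
    = of_int (johnson_eigenvalue (card P) k (n - k) (k - i)) * of_int (pair_fun g P S)"
proof -
  let ?near = "\<lambda>T. card (S - T) = k - i \<and> card (T - S) = k - i"
  have S: "S \<subseteq> {1..n}" "card S = k" "finite S"
    using assms(5) finite_subset by (auto simp: johnson_vertices_def)
  have cards: "card S = card (S \<inter> T) + card (S - T)" "card T = card (S \<inter> T) + card (T - S)"
    if "T \<subseteq> {1..n}" for T
  proof -
    have "finite T" using that finite_subset by auto
    then show "card S = card (S \<inter> T) + card (S - T)" "card T = card (S \<inter> T) + card (T - S)"
      using card_Int_Diff[of S T] card_Int_Diff[of T S] S(3) by (simp_all add: Int_commute)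
  qed
  have "(\<Sum>T\<in>johnson_vertices n k. adj_matrix (johnson_adj i) S T * of_int (pair_fun g P T))
      = (\<Sum>T\<in>Pow {1..n}. complex_of_int (of_bool (?near T) * pair_fun g P T))"
  proof (rule sum.mono_neutral_cong_left)
    have "\<not> ?near T" if "T \<subseteq> {1..n}" "card T \<noteq> k" for T
      using cards[OF that(1)] S(2) that(2) by linarith
    then show "\<forall>T\<in>Pow {1..n} - johnson_vertices n k. complex_of_int (of_bool (?near T) * pair_fun g P T) = 0"
      by (simp add: johnson_vertices_def)
  next
    fix T assume "T \<in> johnson_vertices n k"
    then have T: "T \<subseteq> {1..n}" "card T = k" by (auto simp: johnson_vertices_def)
    have "card (S \<inter> T) = i \<longleftrightarrow> ?near T"
      using cards[OF T(1)] S(2) T(2) assms(1) by arith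
    moreover have "S \<noteq> T" if "card (S \<inter> T) = i"
      using that S(2) assms(1) by auto
    ultimately have "johnson_adj i S T \<longleftrightarrow> ?near T"
      unfolding johnson_adj_def by blast
    then show "adj_matrix (johnson_adj i) S T * of_int (pair_fun g P T)
        = complex_of_int (of_bool (?near T) * pair_fun g P T)"
      by (simp add: adj_matrix_def)
  qed (auto simp: johnson_vertices_def)
  also have "\<dots> = of_int (\<Sum>T\<in>Pow {1..n}. of_bool (?near T) * pair_fun g P T)"
    by (simp only: of_int_sum)
  also have "\<dots> = of_int (johnson_eigenvalue (card P) k (n - k) (k - i) * pair_fun g P S)"
    using assms S finite_subset[OF assms(2)]
    by (subst pair_fun_eigenfunction) (auto simp: card_Diff_subset)
  finally show ?thesis by simp
qed

lemma johnson_perfect_transfer_phase: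
  assumes "i < k" "u \<in> johnson_vertices n k" "v \<in> johnson_vertices n k"
    and "cmod (transition_matrix (johnson_vertices n k) (johnson_adj i) t u v) = 1"
    and "P \<subseteq> {1..n}" "inj_on g P" "g ` P \<subseteq> {1..n} - P"
  shows "transition_matrix (johnson_vertices n k) (johnson_adj i) t u v * of_int (pair_fun g P v)
    = exp (\<i> * complex_of_real t * of_int (johnson_eigenvalue (card P) k (n - k) (k - i)))
        * of_int (pair_fun g P u)"
  using assms
  by (intro perfect_transfer_eigenfunction finite_johnson_vertices johnson_adj_commute
      johnson_adj_pair_fun)

text \<open>A single pair a, b gives an eigenfunction that vanishes at a set exactly when the set
  does not separate a from b. As the transfer entry is nonzero, v separates no two points that u
  leaves together. Thus v is constant on u and on its complement.\<close>

lemma johnson_perfect_transfer_complement: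
  assumes "i < k" "u \<in> johnson_vertices n k" "v \<in> johnson_vertices n k" "u \<noteq> v"
    and "cmod (transition_matrix (johnson_vertices n k) (johnson_adj i) t u v) = 1"
  shows "v = {1..n} - u"
proof -
  have uv: "u \<subseteq> {1..n}" "v \<subseteq> {1..n}" "card u = k" "card v = k" "finite u" "finite v"
    using assms(2,3) finite_subset by (auto simp: johnson_vertices_def)
  let ?H = "transition_matrix (johnson_vertices n k) (johnson_adj i) t u v"
  have same: "a \<in> v \<longleftrightarrow> b \<in> v"
    if "a \<in> {1..n}" "b \<in> {1..n}" "a \<noteq> b" "a \<in> u \<longleftrightarrow> b \<in> u" for a b
  proof -
    have "?H * of_int (pair_fun (\<lambda>_. b) {a} v)
      = exp (\<i> * complex_of_real t * of_int (johnson_eigenvalue (card {a}) k (n - k) (k - i)))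
        * of_int (pair_fun (\<lambda>_. b) {a} u)"
      using assms that by (intro johnson_perfect_transfer_phase) auto
    moreover have "?H \<noteq> 0" using assms(5) by auto
    ultimately show ?thesis
      using that(4) by (auto simp: pair_fun_def split: if_splits)
  qed
  have "\<not> u \<subseteq> v" "\<not> v \<subseteq> u"
    using card_subset_eq[of v u] card_subset_eq[of u v] uv assms(4) by auto
  then obtain a b where ab: "a \<in> u" "a \<notin> v" "b \<in> v" "b \<notin> u" by blast
  \<comment> \<open>Since a lies in u but not in v, and b in v but not in u, v misses all of u and
    contains everything outside u.\<close>
  have "x \<in> v \<longleftrightarrow> x \<notin> u" if "x \<in> {1..n}" for x
    using same[of x a] same[of x b] ab uv that by blast
  then show ?thesis using uv by blast
qed

lemma johnson_perfect_transfer_imp: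
  assumes "i < k" "u \<in> johnson_vertices n k" "v \<in> johnson_vertices n k" "u \<noteq> v"
    and pst: "cmod (transition_matrix (johnson_vertices n k) (johnson_adj i) t u v) = 1"
  shows "n = 2 * k \<and> i = 0"
proof -
  have u: "u \<subseteq> {1..n}" "card u = k" "finite u" and v: "card v = k" "finite v"
    using assms(2,3) finite_subset by (auto simp: johnson_vertices_def)
  have compl: "v = {1..n} - u"
    by (rule johnson_perfect_transfer_complement[OF assms])
  have "card {1..n} = card u + card v"
    using u card_mono[OF finite_atLeastAtMost u(1)] compl by (simp add: card_Diff_subset)
  then have n: "n = 2 * k" using u v by simp
  \<comment> \<open>A bijection onto the complement supplies disjoint pairs over any subset P of u,
    so every j up to k is available.\<close>
  obtain g where g: "bij_betw g u v"
    using finite_same_card_bij u v by metis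
  let ?H = "transition_matrix (johnson_vertices n k) (johnson_adj i) t u v"
  define e where "e j = exp (\<i> * complex_of_real t * of_int (johnson_eigenvalue j k k (k - i)))" for j
  have H: "?H * (-1) ^ j = e j" if "j \<le> k" for j
  proof -
    obtain P where P: "P \<subseteq> u" "card P = j"
      using \<open>j \<le> k\<close> u obtain_subset_with_card_n by metis
    have gv: "g x \<in> v" "g x \<notin> u" "x \<notin> v" if "x \<in> P" for x
      using that P bij_betwE[OF g] compl by blast+
    have "inj_on g P"
      using g P by (auto simp: bij_betw_def intro: inj_on_subset)
    moreover have "P \<subseteq> {1..n}" "g ` P \<subseteq> {1..n} - P"
      using P u gv compl by auto
    ultimately have "?H * of_int (pair_fun g P v)
        = exp (\<i> * complex_of_real t * of_int (johnson_eigenvalue (card P) k (n - k) (k - i)))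
          * of_int (pair_fun g P u)"
      using assms by (intro johnson_perfect_transfer_phase) auto
    moreover have "pair_fun g P u = (\<Prod>x\<in>P. 1)" "pair_fun g P v = (\<Prod>x\<in>P. -1)"
      unfolding pair_fun_def using P gv by (auto intro!: prod.cong prod.neutral)
    ultimately show ?thesis by (simp add: e_def n P)
  qed
  \<comment> \<open>The case j = 0 identifies the transfer entry itself as
    \<open>e 0\<close>.\<close>
  have "e j = (-1) ^ j * e 0" if "j \<le> k" for j
    using H[OF that] H[of 0] by (simp add: mult.commute)
  then have "\<not> (0 < k - i \<and> k - i < k)"
    using no_alternating_phases unfolding e_def by blast
  then show ?thesis using n assms(1) by linarith
qed

text \<open>J(2k,k,0) is the perfect matching of complementary sets. On one edge u, v the
  eigenvalues are 1 and -1, so the entry at u, v is i sin t, of modulus 1 at t = pi/2.\<close>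

lemma johnson_perfect_matching_transfer:
  assumes "1 \<le> k"
  shows "admits_PST (johnson_vertices (2 * k) k) (johnson_adj 0)"
proof -
  let ?V = "johnson_vertices (2 * k) k"
  define u where "u = {1..k}"
  define v where "v = {k+1..2*k}"
  let ?H = "transition_matrix ?V (johnson_adj 0) (pi / 2) u"
  have uv: "u \<in> ?V" "v \<in> ?V" "u \<noteq> v" "u \<inter> v = {}"
    using assms by (auto simp: u_def v_def johnson_vertices_def)
  have adj: "johnson_adj 0 S T \<longleftrightarrow> T = {1..2*k} - S" if "S \<in> ?V" "T \<in> ?V" for S T
  proof
    have ST: "S \<subseteq> {1..2*k}" "T \<subseteq> {1..2*k}" "card S = k" "card T = k" "finite S" "finite T"
      using that finite_subset by (auto simp: johnson_vertices_def)
    then have "card ({1..2*k} - S) = k" by (simp add: card_Diff_subset)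
    moreover assume "johnson_adj 0 S T"
    then have "S \<inter> T = {}" using ST by (simp add: johnson_adj_def)
    then have "T \<subseteq> {1..2*k} - S" using ST by auto
    ultimately show "T = {1..2*k} - S" using ST by (intro card_subset_eq) auto
  next
    assume T: "T = {1..2*k} - S"
    \<comment> \<open>A nonempty set differs from its complement, as adjacency demands.\<close>
    have "S \<noteq> {}" using that assms by (auto simp: johnson_vertices_def)
    then show "johnson_adj 0 S T" by (auto simp: T johnson_adj_def)
  qed
  have uv_compl: "v = {1..2*k} - u" by (auto simp: u_def v_def)
  \<comment> \<open>For c = 1 and c = -1 the function with values 1 at u and c at v is an
    eigenfunction for c; at v this uses \<open>c * c = 1\<close>.\<close>
  have transfer: "?H u + c * ?H v = exp (\<i> * complex_of_real (pi / 2) * c)" if "c * c = 1" for c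
  proof -
    define f where "f S = (if S = u then 1 else if S = v then c else 0)" for S
    have two: "(\<Sum>T\<in>?V. h T * f T) = h u + h v * c" for h :: "nat set \<Rightarrow> complex"
    proof -
      have "(\<Sum>T\<in>?V. h T * f T) = (\<Sum>T\<in>{u, v}. h T * f T)"
        using uv by (intro sum.mono_neutral_right finite_johnson_vertices) (auto simp: f_def)
      then show ?thesis using uv by (simp add: f_def)
    qed
    have "(\<Sum>T\<in>?V. adj_matrix (johnson_adj 0) S T * f T) = c * f S" if "S \<in> ?V" for S
    proof -
      have "u = {1..2*k} - S \<longleftrightarrow> S = v" "v = {1..2*k} - S \<longleftrightarrow> S = u"
        using that uv_compl uv(1) by (auto simp: johnson_vertices_def)
      then have "adj_matrix (johnson_adj 0) S u = (if S = v then 1 else 0)"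
        "adj_matrix (johnson_adj 0) S v = (if S = u then 1 else 0)"
        by (simp_all add: adj_matrix_def adj that uv)
      then show ?thesis
        unfolding two using uv(3) \<open>c * c = 1\<close> by (simp add: f_def)
    qed
    then have "(\<Sum>T\<in>?V. ?H T * f T) = exp (\<i> * complex_of_real (pi / 2) * c) * f u"
      by (intro transition_matrix_eigenfunction finite_johnson_vertices uv)
    then show ?thesis unfolding two by (simp add: f_def mult_ac)
  qed
  have "2 * ?H v = (?H u + 1 * ?H v) - (?H u + (-1) * ?H v)" by simp
  also have "\<dots> = exp (\<i> * complex_of_real (pi / 2) * 1) - exp (\<i> * complex_of_real (pi / 2) * (-1))"
    by (subst (1 2) transfer) simp_all
  also have "\<dots> = cis (pi / 2) - cis (- (pi / 2))"
    by (simp add: cis_conv_exp)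
  also have "\<dots> = 2 * \<i>" by (simp add: complex_eq_iff)
  finally have "cmod (?H v) = 1" by simp
  then show ?thesis
    unfolding admits_PST_def using uv pi_half_gt_zero by blast
qed

theorem mainTheorem4:
  fixes n k i :: nat
  assumes "1 \<le> k" and "2 * k \<le> n" and "i < k"
  shows "admits_PST (johnson_vertices n k) (johnson_adj i) \<longleftrightarrow> n = 2 * k \<and> i = 0"
proof
  assume "admits_PST (johnson_vertices n k) (johnson_adj i)"
  then show "n = 2 * k \<and> i = 0"
    unfolding admits_PST_def using johnson_perfect_transfer_imp[OF assms(3)] by blast
next
  assume "n = 2 * k \<and> i = 0"
  then show "admits_PST (johnson_vertices n k) (johnson_adj i)"
    using johnson_perfect_matching_transfer[OF assms(1)] by simp
qed

end
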